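(* Let $y=\frac{p+q}{2(1+pq)}$, $x=yC(y^2)$ and $s^2=\frac{1+pq}{1+x^2}$ (equivalently $s^2=\frac{1+pq}{C(y^2)}$). Then, as formal power series in $p,q,t$, $$\sum_{n\ge1}A_{2n}(p,q)\frac{t^{2n}}{(2n)!}=\frac{1+x}{1+q}\left\{\frac{\mathcal E(x;st)+\mathcal E(x;-st)}{2}-1\right\},\qquad \sum_{n\ge0}A_{2n+1}(p,q)\frac{t^{2n+1}}{(2n+1)!}=\frac{\mathcal E(x;st)-\mathcal E(x;-st)}{2s},$$ where only even powers of $s$ occur on the right-hand sides.
   Context: For a permutation $\pi=a_1\cdots a_n$ of $[n]$, an index $i\in[n-1]$ is a descent if $a_i>a_{i+1}$; $\mathrm{odes}(\pi)$ and $\mathrm{edes}(\pi)$ count descents at odd and even positions. $A_n(p,q)=\sum_{\pi\in\mathfrak S_n}p^{\mathrm{odes}(\pi)}q^{\mathrm{edes}(\pi)}$ for $n\ge1$. $A_n(q)=\sum_{\pi\in\mathfrak S_n}q^{\mathrm{des}(\pi)}$ is the Eulerian polynomial, and $\mathcal E(q;t)=1+\sum_{n\ge1}A_n(q)\frac{t^n}{n!}=\frac{1-q}{e^{t(q-1)}-q}$. $C(y)=\frac{1-\sqrt{1-4y}}{2y}=\sum_{n\ge0}\frac{1}{n+1}\binom{2n}{n}y^n$ is the Catalan generating function. *)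

theory Defs
  imports "HOL-Computational_Algebra.Formal_Power_Series" "HOL-Combinatorics.Permutations"
begin

(* Bivariate formal power series in p,q are modelled as nested FPS:
   type  real fps fps  = series in q whose coefficients are series in p.
   The (i,j)-coefficient (of p^i q^j) of f is  fps_nth (fps_nth f j) i. *)

type_synonym fps2 = "real fps fps"

definition var_p :: fps2 where "var_p = fps_const fps_X"
definition var_q :: fps2 where "var_q = fps_X"

definition coeff2 :: "fps2 \<Rightarrow> nat \<Rightarrow> nat \<Rightarrow> real" where
  "coeff2 f i j = fps_nth (fps_nth f j) i"

definition is_descent :: "(nat \<Rightarrow> nat) \<Rightarrow> nat \<Rightarrow> bool" where
  "is_descent \<pi> i \<longleftrightarrow> \<pi> i > \<pi> (Suc i)"

definition des :: "nat \<Rightarrow> (nat \<Rightarrow> nat) \<Rightarrow> nat" where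
  "des n \<pi> = card {i \<in> {1..<n}. is_descent \<pi> i}"

definition odes :: "nat \<Rightarrow> (nat \<Rightarrow> nat) \<Rightarrow> nat" where
  "odes n \<pi> = card {i \<in> {1..<n}. odd i \<and> is_descent \<pi> i}"

definition edes :: "nat \<Rightarrow> (nat \<Rightarrow> nat) \<Rightarrow> nat" where
  "edes n \<pi> = card {i \<in> {1..<n}. even i \<and> is_descent \<pi> i}"

definition Apq :: "nat \<Rightarrow> fps2" where
  "Apq n = (\<Sum>\<pi> \<in> {\<pi>. \<pi> permutes {1..n}}. var_p ^ odes n \<pi> * var_q ^ edes n \<pi>)"

definition eulerian :: "nat \<Rightarrow> 'a::comm_ring_1 \<Rightarrow> 'a" where
  "eulerian n z = (\<Sum>\<pi> \<in> {\<pi>. \<pi> permutes {1..n}}. z ^ des n \<pi>)"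

definition catalan_fps :: "real fps" where
  "catalan_fps = Abs_fps (\<lambda>k. real ((2*k) choose k) / real (k+1))"

(* Substitution a(u) of a univariate series a into a bivariate series u with zero
   constant term: since u^k only has monomials of total degree >= k, the
   (i,j)-coefficient of sum_k a_k u^k is the finite sum below. *)
definition subst2 :: "real fps \<Rightarrow> fps2 \<Rightarrow> fps2" where
  "subst2 a u = Abs_fps (\<lambda>j. Abs_fps (\<lambda>i. \<Sum>k\<le>i+j. fps_nth a k * coeff2 (u ^ k) i j))"

definition yser :: fps2 where
  "yser = (var_p + var_q) * inverse (2 * (1 + var_p * var_q))"

definition xser :: fps2 where
  "xser = yser * subst2 catalan_fps (yser ^ 2)"

definition s2ser :: fps2 where
  "s2ser = (1 + var_p * var_q) * inverse (subst2 catalan_fps (yser ^ 2))"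

definition sc :: "real \<Rightarrow> fps2" where "sc c = fps_const (fps_const c)"

(* Series in t with bivariate coefficients.
   E(x;u) = 1 + sum_{m>=1} A_m(x) u^m/m!.  With u = s t and s^2 = S2:
   (E(x;st)+E(x;-st))/2  = sum_{m even} A_m(x) (s^2)^(m/2) t^m/m!
   (E(x;st)-E(x;-st))/(2s) = sum_{m odd} A_m(x) (s^2)^((m-1)/2) t^m/m!
   (with A_0(x) = 1, matching the leading 1 of E). *)
definition E_even :: "fps2 \<Rightarrow> fps2 \<Rightarrow> fps2 fps" where
  "E_even x S2 = Abs_fps (\<lambda>m. if even m then
      (if m = 0 then 1 else eulerian m x) * S2 ^ (m div 2) * sc (1 / fact m) else 0)"

definition E_odd_div_s :: "fps2 \<Rightarrow> fps2 \<Rightarrow> fps2 fps" where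
  "E_odd_div_s x S2 = Abs_fps (\<lambda>m. if odd m then
      eulerian m x * S2 ^ (m div 2) * sc (1 / fact m) else 0)"

end

(* Splitting permutations at their maximum gives a quadratic recurrence for A_n(p,q) and A_n(q,p).
   The parameters x and s2 satisfy 2 x s2 = p + q and (1 + x)^2 s2 = (1 + p)(1 + q), and with these
   two relations the recurrence is turned, by induction on n, into the one for A_n(x):
   A_n(p,q) = A_n(x) s2^((n-1)/2) for odd n, and (1 + q) A_n(p,q) = (1 + x) A_n(x) s2^(n/2) for
   even n > 0. For even n the parts of the convolution with k even and k odd carry different weights
   p and q; their difference is controlled by the functional equation
   (1 + x) E(t) E(-t) - x (E(t) + E(-t)) + x - 1 = 0 of the Eulerian generating function, whose
   left-hand side H solves the linear equation H' = x (E(t) - E(-t)) H with H(0) = 0. *)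

theory Submission
  imports Defs "HOL-Combinatorics.Multiset_Permutations"
begin

unbundle fps_syntax

section \<open>Splitting permutations at their maximum\<close>

text \<open>The parameters swap at each recursive call, so \<open>a\<close> marks descents at odd
  positions and \<open>b\<close> those at even positions, counted from 1.\<close>

fun descent_weight :: "'a::comm_ring_1 \<Rightarrow> 'a \<Rightarrow> nat list \<Rightarrow> 'a" where
  "descent_weight a b (x # y # zs) = (if x > y then a else 1) * descent_weight b a (y # zs)"
| "descent_weight a b _ = 1"

text \<open>List indices start at 0, so an even index stands for an odd position.\<close>

lemma descent_weight_prod:
  "descent_weight a b xs =
    (\<Prod>i<length xs - 1. if xs ! i > xs ! Suc i then if even i then a else b else 1)"
proof (induction a b xs rule: descent_weight.induct)
  case (1 a b x y zs)
  let ?t = "\<lambda>i. if (x # y # zs) ! i > (x # y # zs) ! Suc i then if even i then a else b else 1"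
  have "(\<Prod>i<length (x # y # zs) - 1. ?t i) = ?t 0 * (\<Prod>i<length zs. ?t (Suc i))"
    by (simp only: prod.lessThan_Suc_shift list.size diff_Suc_1 add_Suc_right add_0_right)
  also have "(\<Prod>i<length zs. ?t (Suc i)) = descent_weight b a (y # zs)"
    unfolding 1 by (intro prod.cong) auto
  finally show ?case by simp
qed auto

lemma descent_weight_Cons_max:
  assumes "\<forall>y\<in>set ys. y < m"
  shows "descent_weight a b (m # ys) = (if ys = [] then 1 else a * descent_weight b a ys)"
  using assms by (cases ys) auto

text \<open>No descent leads into \<open>m\<close>, and \<open>m\<close> stands at position
  \<open>length xs + 1\<close>, so the parity of the prefix decides which weight comes first from
  there on.\<close>

lemma descent_weight_append_max:
  assumes "\<forall>x\<in>set xs. x < m"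
  shows "descent_weight a b (xs @ m # ys) = descent_weight a b xs *
    (if even (length xs) then descent_weight a b (m # ys) else descent_weight b a (m # ys))"
  using assms
proof (induction xs arbitrary: a b)
  case (Cons x xs)
  then show ?case by (cases xs) (auto simp: algebra_simps)
qed simp

text \<open>Arbitrary sets of letters are allowed because the words on the two sides of a maximum
  run over complementary subsets.\<close>

definition descent_sum :: "nat set \<Rightarrow> 'a::comm_ring_1 \<Rightarrow> 'a \<Rightarrow> 'a" where
  "descent_sum A a b = (\<Sum>xs\<in>permutations_of_set A. descent_weight a b xs)"

text \<open>\<open>B\<close> is the set of letters to the left of \<open>m\<close>; the cut is
  unique because \<open>m\<close> occurs just once.\<close>

lemma permutations_of_set_insert_split:
  assumes "m \<notin> A"
  shows "bij_betw (\<lambda>(B, xs, ys). xs @ m # ys)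
    (SIGMA B:Pow A. permutations_of_set B \<times> permutations_of_set (A - B))
    (permutations_of_set (insert m A))"
proof (rule bij_betw_imageI)
  show "inj_on (\<lambda>(B, xs, ys). xs @ m # ys)
      (SIGMA B:Pow A. permutations_of_set B \<times> permutations_of_set (A - B))"
  proof (rule inj_onI, unfold mem_Sigma_iff split_paired_all prod.case mem_Times_iff fst_conv snd_conv)
    fix B xs ys B' xs' ys'
    assume 1: "B \<in> Pow A \<and> xs \<in> permutations_of_set B \<and> ys \<in> permutations_of_set (A - B)"
      and 2: "B' \<in> Pow A \<and> xs' \<in> permutations_of_set B' \<and> ys' \<in> permutations_of_set (A - B')"
      and eq: "xs @ m # ys = xs' @ m # ys'"
    have sets: "set xs = B" "set xs' = B'" "set ys = A - B" "set ys' = A - B'"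
      using 1 2 by (simp_all add: permutations_of_setD(1))
    then have "m \<notin> set xs" "m \<notin> set ys"
      using 1 2 assms by auto
    with eq have "xs = xs' \<and> ys = ys'"
      using append_Cons_eq_iff[of m xs ys xs' ys'] by simp
    with sets show "(B, xs, ys) = (B', xs', ys')"
      by simp
  qed
  show "(\<lambda>(B, xs, ys). xs @ m # ys) `
      (SIGMA B:Pow A. permutations_of_set B \<times> permutations_of_set (A - B)) =
      permutations_of_set (insert m A)" (is "?f ` ?D = ?R")
  proof (intro equalityI subsetI)
    fix zs assume "zs \<in> ?R"
    then have zs: "set zs = insert m A" "distinct zs"
      by (simp_all add: permutations_of_setD)
    then obtain xs ys where split: "zs = xs @ m # ys"
      by (metis in_set_conv_decomp insertI1)
    with zs have "m \<notin> set xs \<union> set ys" "set xs \<inter> set ys = {}" "distinct xs" "distinct ys"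
      by auto
    moreover from this(1) zs(1) have "A = set xs \<union> set ys"
      using assms unfolding split by auto
    ultimately have "(set xs, xs, ys) \<in> ?D"
      by (auto intro!: permutations_of_setI)
    then show "zs \<in> ?f ` ?D"
      by (rule rev_image_eqI) (simp add: split)
  next
    fix zs assume "zs \<in> ?f ` ?D"
    then obtain B xs ys where "B \<subseteq> A" "xs \<in> permutations_of_set B"
        "ys \<in> permutations_of_set (A - B)" and zs: "zs = xs @ m # ys"
      by auto
    then have "B \<subseteq> A" "set xs = B" "set ys = A - B" "distinct xs" "distinct ys"
      by (simp_all add: permutations_of_setD)
    then show "zs \<in> ?R"
      using assms unfolding zs by (intro permutations_of_setI) auto
  qed
qed

text \<open>If \<open>B = A\<close>, the maximum comes last and creates no descent. Otherwise it
  creates one at position \<open>card B + 1\<close>, which is odd for even \<open>card B\<close>,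
  and the suffix starts at the opposite parity.\<close>

lemma descent_sum_insert_max:
  fixes a b :: "'a::comm_ring_1"
  assumes "finite A" and less: "\<forall>x\<in>A. x < m"
  shows "descent_sum (insert m A) a b = (\<Sum>B\<in>Pow A. descent_sum B a b *
    (if B = A then 1 else if even (card B) then a * descent_sum (A - B) b a
     else b * descent_sum (A - B) a b))"
proof -
  \<comment> \<open>\<open>h B\<close> is the joint contribution of the maximum and the suffix
    \<open>ys\<close>.\<close>
  define h where "h B = (if B = A then (\<lambda>_. 1) else if even (card B)
    then (\<lambda>ys. a * descent_weight b a ys) else (\<lambda>ys. b * descent_weight a b ys))" for B
  have "m \<notin> A" using less by auto
  from sum.reindex_bij_betw[OF permutations_of_set_insert_split[OF this],
      of "descent_weight a b", symmetric]
  have "descent_sum (insert m A) a b =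
    (\<Sum>(B, xs, ys)\<in>(SIGMA B:Pow A. permutations_of_set B \<times> permutations_of_set (A - B)).
      descent_weight a b (xs @ m # ys))"
    by (simp add: descent_sum_def case_prod_unfold)
  also have "\<dots> = (\<Sum>(B, xs, ys)\<in>(SIGMA B:Pow A. permutations_of_set B \<times> permutations_of_set (A - B)).
      descent_weight a b xs * h B ys)"
  proof (intro sum.cong refl, clarify)
    fix B xs ys
    assume *: "B \<subseteq> A" "xs \<in> permutations_of_set B" "ys \<in> permutations_of_set (A - B)"
    then have "length xs = card B" "ys = [] \<longleftrightarrow> B = A"
      by (auto simp: permutations_of_set_def distinct_card)
    moreover have "\<forall>x\<in>set xs. x < m" "\<forall>y\<in>set ys. y < m"
      using * less by (auto simp: permutations_of_set_def)
    ultimately show "descent_weight a b (xs @ m # ys) = descent_weight a b xs * h B ys"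
      by (simp add: h_def descent_weight_append_max descent_weight_Cons_max)
  qed
  also have "\<dots> = (\<Sum>B\<in>Pow A. descent_sum B a b * (\<Sum>ys\<in>permutations_of_set (A - B). h B ys))"
    using assms(1)
    by (subst sum.Sigma[symmetric]) (auto simp: finite_subset descent_sum_def
        sum_product sum.cartesian_product)
  also have "\<dots> = (\<Sum>B\<in>Pow A. descent_sum B a b *
    (if B = A then 1 else if even (card B) then a * descent_sum (A - B) b a
     else b * descent_sum (A - B) a b))"
    by (intro sum.cong refl) (simp add: h_def descent_sum_def sum_distrib_left)
  finally show ?thesis .
qed

lemma sum_Pow_card:
  fixes f :: "nat \<Rightarrow> 'a::comm_ring_1"
  assumes "finite A"
  shows "(\<Sum>B\<in>Pow A. f (card B)) = (\<Sum>k\<le>card A. of_nat (card A choose k) * f k)"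
proof -
  have "(\<Sum>B\<in>Pow A. f (card B)) = (\<Sum>k\<le>card A. \<Sum>B\<in>{B\<in>Pow A. card B = k}. f (card B))"
    using assms by (intro sum.group[symmetric]) (auto intro: card_mono)
  also have "\<dots> = (\<Sum>k\<le>card A. of_nat (card A choose k) * f k)"
    using assms by (intro sum.cong refl) (simp add: n_subsets)
  finally show ?thesis .
qed

definition descent_poly :: "nat \<Rightarrow> 'a::comm_ring_1 \<Rightarrow> 'a \<Rightarrow> 'a" where
  "descent_poly n a b = descent_sum {1..n} a b"

text \<open>Splitting a permutation of n + 1 letters at its maximum leaves k letters on the left. For
  k < n the maximum creates a descent at position k + 1, and the right factor starts at position
  k + 2, so its parities are swapped exactly when k is even.\<close>

definition descent_step :: "(nat \<Rightarrow> 'a::comm_ring_1) \<Rightarrow> (nat \<Rightarrow> 'a) \<Rightarrow> 'a \<Rightarrow> 'a \<Rightarrow> nat \<Rightarrow> 'a" where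
  "descent_step P Q a b n = P n + (\<Sum>k<n. of_nat (n choose k) *
     (P k * (if even k then a * Q (n - k) else b * P (n - k))))"

text \<open>Dependence on the cardinality alone is assumed only for subsets of \<open>A\<close>,
  which an induction on the cardinality of \<open>insert m A\<close> can supply.\<close>

lemma descent_sum_step:
  fixes a b :: "'a::comm_ring_1"
  assumes "finite A" "\<forall>x\<in>A. x < m"
    and P: "\<And>B. B \<subseteq> A \<Longrightarrow> descent_sum B a b = P (card B)"
    and Q: "\<And>B. B \<subseteq> A \<Longrightarrow> descent_sum B b a = Q (card B)"
  shows "descent_sum (insert m A) a b = descent_step P Q a b (card A)"
proof -
  define f where "f k = P k * (if k = card A then 1 else if even k then a * Q (card A - k)
    else b * P (card A - k))" for k
  have "descent_sum (insert m A) a b = (\<Sum>B\<in>Pow A. f (card B))"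
    unfolding descent_sum_insert_max[OF assms(1,2)]
  proof (intro sum.cong refl)
    fix B assume B: "B \<in> Pow A"
    then have "B = A \<longleftrightarrow> card B = card A"
      using assms(1) card_subset_eq[of A B] by blast
    then show "descent_sum B a b * (if B = A then 1
       else if even (card B) then a * descent_sum (A - B) b a
       else b * descent_sum (A - B) a b) = f (card B)"
      using B assms(1) by (simp add: f_def P Q card_Diff_subset finite_subset)
  qed
  also have "\<dots> = (\<Sum>k\<le>card A. of_nat (card A choose k) * f k)"
    by (rule sum_Pow_card[OF assms(1)])
  also have "\<dots> = descent_step P Q a b (card A)"
    by (simp add: lessThan_Suc_atMost[symmetric] descent_step_def f_def)
  finally show ?thesis .
qed

text \<open>Only the relative order of the letters matters. A nonempty \<open>A\<close> and
  \<open>{1..card A}\<close> both arise by adding a maximum to a set of \<open>card A - 1\<close>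
  letters, and by induction the resulting step depends on that number alone.\<close>

lemma descent_sum_card:
  fixes a b :: "'a::comm_ring_1"
  assumes "finite A"
  shows "descent_sum A a b = descent_poly (card A) a b"
  using assms
proof (induction "card A" arbitrary: A a b rule: less_induct)
  case less
  show ?case
  proof (cases "A = {}")
    case True
    then show ?thesis by (simp add: descent_poly_def)
  next
    case False
    define A' where "A' = A - {Max A}"
    have "Max A \<in> A" using False less.prems by (rule Max_in[rotated])
    then have A: "A = insert (Max A) A'" and "finite A'" and Max: "\<forall>x\<in>A'. x < Max A"
      using less.prems by (auto simp: A'_def order.strict_iff_order)
    have card: "card A = Suc (card A')"
      using False less.prems by (simp add: A'_def card.remove card_gt_0_iff)
    have IH: "descent_sum B a b = descent_poly (card B) a b"
      if "finite B" "card B \<le> card A'" for B and a b :: 'a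
      using less.hyps[of B] that card by simp
    have "descent_sum A a b =
        descent_step (\<lambda>k. descent_poly k a b) (\<lambda>k. descent_poly k b a) a b (card A')"
      by (subst A, intro descent_sum_step IH)
         (use \<open>finite A'\<close> Max in
           \<open>auto intro: finite_subset[OF _ \<open>finite A'\<close>] card_mono[OF \<open>finite A'\<close>]\<close>)
    also have "\<dots> = descent_step (\<lambda>k. descent_poly k a b) (\<lambda>k. descent_poly k b a) a b
        (card {1..card A'})"
      by simp
    also have "\<dots> = descent_sum (insert (card A) {1..card A'}) a b"
      using card by (intro descent_sum_step[symmetric] IH)
        (auto intro: finite_subset[OF _ finite_atLeastAtMost]
          dest: card_mono[OF finite_atLeastAtMost])
    also have "insert (card A) {1..card A'} = {1..card A}"
      using card by auto
    finally show ?thesis by (simp add: descent_poly_def)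
  qed
qed

lemma descent_poly_0 [simp]: "descent_poly 0 a b = 1"
  by (simp add: descent_poly_def descent_sum_def)

lemma descent_poly_Suc:
  "descent_poly (Suc n) a b =
    descent_step (\<lambda>k. descent_poly k a b) (\<lambda>k. descent_poly k b a) a b n"
proof -
  have "descent_poly (Suc n) a b = descent_sum (insert (Suc n) {1..n}) a b"
    by (simp add: descent_poly_def atLeastAtMostSuc_conv)
  also have "\<dots> = descent_step (\<lambda>k. descent_poly k a b) (\<lambda>k. descent_poly k b a) a b
      (card {1..n})"
    by (intro descent_sum_step descent_sum_card) (auto intro: finite_subset[OF _ finite_atLeastAtMost])
  finally show ?thesis by simp
qed

section \<open>From permutations as functions to words\<close>

lemma bij_betw_permutes_lists:
  "bij_betw (\<lambda>\<pi>. map \<pi> [1..<Suc n]) {\<pi>. \<pi> permutes {1..n}} (permutations_of_set {1..n})"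
  (is "bij_betw ?f ?S ?T")
proof -
  have inj: "inj_on ?f ?S"
  proof (rule inj_onI, clarify)
    fix \<pi> \<sigma> assume *: "\<pi> permutes {1..n}" "\<sigma> permutes {1..n}" "?f \<pi> = ?f \<sigma>"
    show "\<pi> = \<sigma>"
    proof
      fix i show "\<pi> i = \<sigma> i"
      proof (cases "i \<in> {1..n}")
        case True
        then have "i \<in> set [1..<Suc n]" by auto
        with *(3) show ?thesis by (metis map_eq_conv)
      qed (use *(1,2) in \<open>simp add: permutes_not_in del: atLeastAtMost_iff\<close>)
    qed
  qed
  have sub: "?f ` ?S \<subseteq> ?T"
  proof clarify
    fix \<pi> assume "\<pi> permutes {1..n}"
    moreover have "set [1..<Suc n] = {1..n}" by auto
    ultimately show "?f \<pi> \<in> ?T"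
      by (intro permutations_of_setI)
         (simp_all only: set_map distinct_map permutes_image permutes_inj_on, simp)
  qed
  \<comment> \<open>Surjectivity is by counting: the injective image and the target both have
    \<open>n!\<close> elements.\<close>
  have "?f ` ?S = ?T"
    using sub card_permutations[of "{1..n}" n]
    by (intro card_subset_eq) (simp_all only: card_image[OF inj], simp_all)
  with inj show ?thesis by (simp add: bij_betw_def)
qed

lemma descent_weight_map:
  "descent_weight a b (map \<pi> [1..<Suc n]) =
     a ^ card {i \<in> {1..<n}. odd i \<and> is_descent \<pi> i} *
     b ^ card {i \<in> {1..<n}. even i \<and> is_descent \<pi> i}"
proof -
  have "descent_weight a b (map \<pi> [1..<Suc n]) =
      (\<Prod>i<n - 1. if is_descent \<pi> (Suc i) then if odd (Suc i) then a else b else 1)"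
    unfolding descent_weight_prod
    by (intro prod.cong) (auto simp: is_descent_def simp del: upt_Suc)
  also have "\<dots> = (\<Prod>i\<in>{1..<n}. if is_descent \<pi> i then if odd i then a else b else 1)"
    by (rule prod.reindex_bij_witness[where i = "\<lambda>i. i - 1" and j = Suc]) auto
  also have "\<dots> = (\<Prod>i\<in>{1..<n}. (if odd i \<and> is_descent \<pi> i then a else 1) *
      (if even i \<and> is_descent \<pi> i then b else 1))"
    by (intro prod.cong) auto
  also have "\<dots> = a ^ card {i \<in> {1..<n}. odd i \<and> is_descent \<pi> i} *
     b ^ card {i \<in> {1..<n}. even i \<and> is_descent \<pi> i}"
    by (simp add: prod.distrib prod.If_cases Int_def)
  finally show ?thesis .
qed

lemma descent_poly_permutes:
  "descent_poly n a b = (\<Sum>\<pi> | \<pi> permutes {1..n}. a ^ odes n \<pi> * b ^ edes n \<pi>)"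
  unfolding descent_poly_def descent_sum_def odes_def edes_def descent_weight_map[symmetric]
  by (rule sum.reindex_bij_betw[OF bij_betw_permutes_lists, symmetric])

lemma Apq_eq_descent_poly: "Apq n = descent_poly n var_p var_q"
  by (simp add: Apq_def descent_poly_permutes)

lemma eulerian_eq_descent_poly: "eulerian n z = descent_poly n z z"
proof -
  have "des n \<pi> = odes n \<pi> + edes n \<pi>" for \<pi>
    unfolding des_def odes_def edes_def
    by (subst card_Un_disjoint[symmetric]) (auto intro: arg_cong[where f = card])
  then show ?thesis
    by (simp add: eulerian_def descent_poly_permutes power_add)
qed

lemma eulerian_0 [simp]: "eulerian 0 z = 1"
  by (simp add: eulerian_eq_descent_poly)

lemma eulerian_Suc:
  "eulerian (Suc n) z = eulerian n z +
    z * (\<Sum>k<n. of_nat (n choose k) * (eulerian k z * eulerian (n - k) z))"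
  by (simp add: eulerian_eq_descent_poly descent_poly_Suc descent_step_def sum_distrib_left
      algebra_simps)

section \<open>Bivariate power series and substitution\<close>

text \<open>For \<open>fps2\<close> the coefficients lie in \<open>real fps\<close>, which is not a
  field, so the hypothesis makes the constant coefficient a unit.\<close>

lemma fps_mult_inverse:
  fixes f :: "'a::{comm_ring_1,inverse} fps"
  assumes "f $ 0 * inverse (f $ 0) = 1"
  shows "f * inverse f = 1"
  unfolding fps_inverse_def by (rule fps_right_inverse[OF assms])

lemma sc_mult: "sc x * sc y = sc (x * y)"
  by (simp add: sc_def)

lemma coeff2_0 [simp]: "coeff2 0 i j = 0"
  by (simp add: coeff2_def)

lemma coeff2_add: "coeff2 (f + g) i j = coeff2 f i j + coeff2 g i j"
  by (simp add: coeff2_def)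

lemma coeff2_sum: "coeff2 (sum f A) i j = (\<Sum>x\<in>A. coeff2 (f x) i j)"
  by (simp add: coeff2_def fps_sum_nth)

lemma coeff2_sc_mult: "coeff2 (sc c * f) i j = c * coeff2 f i j"
  by (simp add: coeff2_def sc_def)

lemma coeff2_mult:
  "coeff2 (f * g) i j = (\<Sum>l\<le>j. \<Sum>k\<le>i. coeff2 f k l * coeff2 g (i - k) (j - l))"
  by (simp add: coeff2_def fps_mult_nth fps_sum_nth atLeast0AtMost)

lemma fps2_eqI: "(\<And>i j. coeff2 f i j = coeff2 g i j) \<Longrightarrow> f = g"
  by (simp add: coeff2_def fps_eq_iff)

lemma inverse_fps2:
  assumes "coeff2 f 0 0 \<noteq> 0"
  shows "f * inverse f = 1"
  using assms by (intro fps_mult_inverse) (simp add: coeff2_def inverse_mult_eq_1')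

section \<open>Truncation by total degree in p and q\<close>

definition order_ge :: "nat \<Rightarrow> fps2 \<Rightarrow> bool" where
  "order_ge n f \<longleftrightarrow> (\<forall>i j. i + j < n \<longrightarrow> coeff2 f i j = 0)"

lemma order_ge_mult:
  assumes "order_ge m f" "order_ge n g"
  shows "order_ge (m + n) (f * g)"
  unfolding order_ge_def
proof (intro allI impI)
  fix i j assume "i + j < m + n"
  have "coeff2 f k l * coeff2 g (i - k) (j - l) = 0" if "k \<le> i" "l \<le> j" for k l
  proof -
    have "k + l < m \<or> (i - k) + (j - l) < n"
      using \<open>i + j < m + n\<close> that by linarith
    then show ?thesis using assms by (auto simp: order_ge_def)
  qed
  then show "coeff2 (f * g) i j = 0"
    by (simp only: coeff2_mult) (intro sum.neutral ballI; simp)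
qed

lemma order_ge_power:
  assumes "order_ge 1 f"
  shows "order_ge n (f ^ n)"
proof (induction n)
  case (Suc n)
  from order_ge_mult[OF assms this] show ?case by simp
qed (simp add: order_ge_def)

definition eq_upto :: "nat \<Rightarrow> fps2 \<Rightarrow> fps2 \<Rightarrow> bool" where
  "eq_upto n f g \<longleftrightarrow> (\<forall>i j. i + j \<le> n \<longrightarrow> coeff2 f i j = coeff2 g i j)"

lemma eq_upto_mult:
  assumes "eq_upto n f f'" "eq_upto n g g'"
  shows "eq_upto n (f * g) (f' * g')"
  unfolding eq_upto_def
proof (intro allI impI)
  fix i j assume "i + j \<le> n"
  then show "coeff2 (f * g) i j = coeff2 (f' * g') i j"
    unfolding coeff2_mult using assms
    by (intro sum.cong refl arg_cong2[where f = times]) (auto simp: eq_upto_def)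
qed

text \<open>The cutoff in \<open>subst2\<close> varies with the coefficient. Since
  \<open>u ^ k\<close> has order at least \<open>k\<close>, one partial sum serves all coefficients
  of total degree at most \<open>n\<close>.\<close>

lemma eq_upto_subst2:
  assumes "order_ge 1 u"
  shows "eq_upto n (subst2 a u) (\<Sum>k\<le>n. sc (a $ k) * u ^ k)"
  unfolding eq_upto_def
proof (intro allI impI)
  fix i j assume "i + j \<le> n"
  have "coeff2 (subst2 a u) i j = (\<Sum>k\<le>i + j. a $ k * coeff2 (u ^ k) i j)"
    by (simp add: subst2_def coeff2_def)
  also have "\<dots> = (\<Sum>k\<le>n. a $ k * coeff2 (u ^ k) i j)"
    using \<open>i + j \<le> n\<close> order_ge_power[OF assms]
    by (intro sum.mono_neutral_left) (auto simp: order_ge_def)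
  finally show "coeff2 (subst2 a u) i j = coeff2 (\<Sum>k\<le>n. sc (a $ k) * u ^ k) i j"
    by (simp add: coeff2_sum coeff2_sc_mult)
qed

lemma subst2_add: "subst2 (a + b) u = subst2 a u + subst2 b u"
  by (simp add: subst2_def fps_eq_iff sum.distrib algebra_simps)

lemma subst2_1: "subst2 1 u = 1"
  by (rule fps2_eqI) (simp add: subst2_def coeff2_def if_distribR if_distrib[of "\<lambda>x. x * _"]
      cong: if_cong)

lemma subst2_X:
  assumes "order_ge 1 u"
  shows "subst2 fps_X u = u"
proof (rule fps2_eqI)
  fix i j
  \<comment> \<open>The cutoff \<open>Suc (i + j)\<close> keeps the index \<open>k = 1\<close> in
    the sum even for \<open>i = j = 0\<close>.\<close>
  have "coeff2 (subst2 fps_X u) i j = coeff2 (\<Sum>k\<le>Suc (i + j). sc (fps_X $ k) * u ^ k) i j"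
    using eq_upto_subst2[OF assms, of "Suc (i + j)" fps_X] by (simp add: eq_upto_def)
  also have "\<dots> = (\<Sum>k\<le>Suc (i + j). if k = 1 then coeff2 u i j else 0)"
    unfolding coeff2_sum coeff2_sc_mult by (intro sum.cong) auto
  finally show "coeff2 (subst2 fps_X u) i j = coeff2 u i j"
    by simp
qed

text \<open>The pairs with \<open>k + l \<le> n\<close> form the truncated Cauchy product. For
  \<open>u\<close> without constant term, the remaining pairs only contribute in total degree above
  \<open>n\<close>.\<close>

lemma sum_mult_power_truncate:
  fixes a b :: "real fps" and n :: nat
  shows "(\<Sum>k\<le>n. sc (a $ k) * u ^ k) * (\<Sum>k\<le>n. sc (b $ k) * u ^ k) =
    (\<Sum>k\<le>n. sc ((a * b) $ k) * u ^ k) +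
    (\<Sum>(k, l)\<in>{(k, l). k \<le> n \<and> l \<le> n \<and> n < k + l}. sc (a $ k * b $ l) * u ^ (k + l))"
proof -
  let ?t = "\<lambda>(k, l). sc (a $ k * b $ l) * u ^ (k + l)"
  let ?L = "{(k::nat, l). k + l \<le> n}" and ?H = "{(k::nat, l). k \<le> n \<and> l \<le> n \<and> n < k + l}"
  have fin: "finite ?L" "finite ?H"
    by (rule finite_subset[of _ "{..n} \<times> {..n}"]; auto)+
  have sc_sum: "sc (sum f A) = (\<Sum>x\<in>A. sc (f x))" for f :: "nat \<Rightarrow> real" and A
    by (induction A rule: infinite_finite_induct)
       (simp_all add: sc_def del: fps_const_add add: fps_const_add[symmetric])
  have "(\<Sum>k\<le>n. sc (a $ k) * u ^ k) * (\<Sum>k\<le>n. sc (b $ k) * u ^ k) = sum ?t ({..n} \<times> {..n})"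
    by (simp add: sum_product sum.cartesian_product power_add sc_mult[symmetric] mult_ac)
  also have "{..n} \<times> {..n} = ?L \<union> ?H"
    by auto
  also have "sum ?t (?L \<union> ?H) = sum ?t ?L + sum ?t ?H"
    using fin by (intro sum.union_disjoint) auto
  also have "sum ?t ?L = (\<Sum>m\<le>n. \<Sum>k\<le>m. sc (a $ k * b $ (m - k)) * u ^ m)"
    using sum.triangle_reindex_eq[of "\<lambda>k l. sc (a $ k * b $ l) * u ^ (k + l)" n] by simp
  also have "\<dots> = (\<Sum>m\<le>n. sc ((a * b) $ m) * u ^ m)"
    by (simp add: fps_mult_nth atLeast0AtMost sc_sum sum_distrib_right)
  finally show ?thesis .
qed

lemma subst2_mult:
  assumes "order_ge 1 u"
  shows "subst2 (a * b) u = subst2 a u * subst2 b u"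
proof (rule fps2_eqI)
  fix i j :: nat
  let ?n = "i + j"
  let ?T = "\<lambda>a. \<Sum>k\<le>?n. sc (a $ k) * u ^ k"
  have "coeff2 (subst2 a u * subst2 b u) i j = coeff2 (?T a * ?T b) i j"
    using eq_upto_mult[OF eq_upto_subst2[OF assms] eq_upto_subst2[OF assms], of ?n a b]
    by (simp add: eq_upto_def)
  also have "\<dots> = coeff2 (?T (a * b)) i j"
    unfolding sum_mult_power_truncate coeff2_add coeff2_sum case_prod_unfold coeff2_sc_mult
    using order_ge_power[OF assms] by (auto simp: order_ge_def intro!: sum.neutral)
  also have "\<dots> = coeff2 (subst2 (a * b) u) i j"
    using eq_upto_subst2[OF assms, of ?n "a * b"] by (simp add: eq_upto_def)
  finally show "coeff2 (subst2 (a * b) u) i j = coeff2 (subst2 a u * subst2 b u) i j" ..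
qed

section \<open>The Catalan series\<close>

text \<open>This ratio of consecutive coefficients encodes a first-order linear differential
  equation for the Catalan series.\<close>

lemma catalan_fps_nth_Suc:
  "real (k + 2) * catalan_fps $ Suc k = real (4 * k + 2) * catalan_fps $ k"
proof -
  have 1: "Suc (2 * k) * (2 * k choose k) = Suc k * (Suc (2 * k) choose k)"
    using binomial_symmetric[of k "Suc (2 * k)"] Suc_times_binomial[of k "2 * k"]
    by (simp add: Suc_diff_le)
  have 2: "Suc k * (Suc (Suc (2 * k)) choose Suc k) = Suc (Suc (2 * k)) * (Suc (2 * k) choose k)"
    using Suc_times_binomial[of k "Suc (2 * k)"] by simp
  have "real (Suc k) * real (Suc k * (Suc (Suc (2 * k)) choose Suc k)) =
      real (Suc (Suc (2 * k))) * real (Suc (2 * k) * (2 * k choose k))"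
    unfolding 1 2 of_nat_mult by (simp only: mult_ac)
  then have "real (Suc k) * (real (Suc k) * real (Suc (Suc (2 * k)) choose Suc k)) =
      real (Suc k) * (real (4 * k + 2) * real (2 * k choose k))"
    by (simp add: field_simps)
  then have "real (Suc k) * real (Suc (Suc (2 * k)) choose Suc k) =
      real (4 * k + 2) * real (2 * k choose k)"
    by (subst (asm) mult_cancel_left) simp
  then show ?thesis
    by (simp add: catalan_fps_def field_simps del: binomial_Suc_Suc)
qed

text \<open>Comparing coefficients gives \<open>(n + 1) h_(n+1) = (d + c n) h_n\<close>, so the
  constant term determines the solution.\<close>

lemma fps_linear_ode_unique:
  fixes f g :: "real fps"
  assumes "(1 - fps_const c * fps_X) * fps_deriv f = fps_const d * f"
    and "(1 - fps_const c * fps_X) * fps_deriv g = fps_const d * g" and "f $ 0 = g $ 0"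
  shows "f = g"
proof (rule fps_ext)
  have rec: "real (Suc n) * h $ Suc n = (d + c * real n) * h $ n"
    if "(1 - fps_const c * fps_X) * fps_deriv h = fps_const d * h" for h n
    using arg_cong[OF that, of "\<lambda>u. u $ n"]
    by (cases n) (simp_all add: algebra_simps)
  fix n show "f $ n = g $ n"
  proof (induction n)
    case (Suc n)
    then have "real (Suc n) * f $ Suc n = real (Suc n) * g $ Suc n"
      by (simp only: rec[OF assms(1)] rec[OF assms(2)])
    then show ?case by simp
  qed fact
qed

text \<open>The differential equation for \<open>C\<close> shows that \<open>(1 - 2 X C)^2\<close>
  and \<open>1 - 4 X\<close> solve the same linear equation with the same constant term. Expanding
  their equality and cancelling \<open>4 X\<close> gives the claim.\<close>

lemma catalan_fps_quadratic: "catalan_fps = 1 + fps_X * catalan_fps ^ 2"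
proof -
  let ?X = "fps_X :: real fps" and ?C = catalan_fps
  \<comment> \<open>The coefficient of index \<open>k + 1\<close> on the left is
    \<open>(k + 2) C_(k+1) - (4 k + 2) C_k\<close>.\<close>
  have "?X * fps_deriv ?C - 4 * (?X * (?X * fps_deriv ?C)) + ?C - 2 * (?X * ?C) = 1"
  proof (rule fps_ext)
    fix n
    show "(?X * fps_deriv ?C - 4 * (?X * (?X * fps_deriv ?C)) + ?C - 2 * (?X * ?C)) $ n = 1 $ n"
    proof (cases n)
      case 0
      then show ?thesis by (simp add: catalan_fps_def numeral_fps_const)
    next
      case (Suc k)
      then show ?thesis
        using catalan_fps_nth_Suc[of k]
        by (cases k) (simp_all add: numeral_fps_const, simp_all add: algebra_simps)
    qed
  qed
  then have ode: "?X * (1 - 4 * ?X) * fps_deriv ?C + (1 - 2 * ?X) * ?C = 1"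
    by algebra
  \<comment> \<open>G is the square root of 1 - 4X, characterised by its differential equation.\<close>
  define G where "G = 1 - 2 * ?X * ?C"
  have "(1 - 4 * ?X) * fps_deriv G = -2 * ((1 - 4 * ?X) * ?C + ?X * (1 - 4 * ?X) * fps_deriv ?C)"
    by (simp add: G_def algebra_simps)
  also have "(1 - 4 * ?X) * ?C + ?X * (1 - 4 * ?X) * fps_deriv ?C = G"
    using ode unfolding G_def by algebra
  finally have G: "(1 - 4 * ?X) * fps_deriv G = -2 * G" .
  have "(1 - 4 * ?X) * fps_deriv (G ^ 2) = 2 * G * ((1 - 4 * ?X) * fps_deriv G)"
    by (simp add: power2_eq_square algebra_simps)
  also have "\<dots> = -4 * G ^ 2"
    unfolding G by (simp add: power2_eq_square algebra_simps)
  finally have "(1 - fps_const 4 * ?X) * fps_deriv (G ^ 2) = fps_const (-4) * G ^ 2"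
    by (simp add: numeral_fps_const flip: fps_const_neg)
  moreover have "(1 - fps_const 4 * ?X) * fps_deriv (1 - 4 * ?X) = fps_const (-4) * (1 - 4 * ?X)"
    by (simp add: numeral_fps_const algebra_simps flip: fps_const_neg)
  ultimately have "G ^ 2 = 1 - 4 * ?X"
    by (rule fps_linear_ode_unique) (simp add: G_def power2_eq_square)
  then have "4 * ?X * ?C = 4 * ?X * (1 + ?X * ?C ^ 2)"
    unfolding G_def by algebra
  then show ?thesis
    by simp
qed

section \<open>The algebraic relations between y, x and s^2\<close>

lemma coeff2_yser_0: "coeff2 yser 0 0 = 0"
  by (simp add: yser_def coeff2_mult coeff2_add) (simp add: coeff2_def var_p_def var_q_def)

lemma order_ge_yser2: "order_ge 1 (yser ^ 2)"
  by (simp add: order_ge_def power2_eq_square coeff2_mult coeff2_yser_0)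

lemma yser_eq: "2 * (1 + var_p * var_q) * yser = var_p + var_q"
proof -
  have "coeff2 (2 * (1 + var_p * var_q)) 0 0 \<noteq> 0"
    by (simp add: coeff2_def var_p_def var_q_def fps_mult_nth_0 numeral_fps_const)
  from inverse_fps2[OF this] show ?thesis
    unfolding yser_def by (simp add: mult.left_commute)
qed

definition cser :: fps2 where "cser = subst2 catalan_fps (yser ^ 2)"

text \<open>Substituting \<open>y^2\<close> into the quadratic equation gives
  \<open>C(y^2) = 1 + y^2 C(y^2)^2\<close>, and \<open>x = y C(y^2)\<close>. Hence the two
  descriptions of \<open>s^2\<close> agree.\<close>

lemma cser_eq: "cser = 1 + xser ^ 2"
proof -
  have "cser = subst2 (1 + fps_X * catalan_fps ^ 2) (yser ^ 2)"
    using catalan_fps_quadratic by (simp add: cser_def)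
  also have "\<dots> = 1 + yser ^ 2 * cser ^ 2"
    by (simp only: subst2_add subst2_1 subst2_mult[OF order_ge_yser2] subst2_X[OF order_ge_yser2]
        cser_def power2_eq_square[of catalan_fps] power2_eq_square[of "subst2 _ _"])
  finally show ?thesis
    by (simp add: xser_def cser_def[symmetric] power_mult_distrib)
qed

lemma s2ser_eq: "(1 + xser ^ 2) * s2ser = 1 + var_p * var_q"
proof -
  have "coeff2 cser 0 0 \<noteq> 0"
    by (simp add: cser_def subst2_def coeff2_def catalan_fps_def)
  from inverse_fps2[OF this] show ?thesis
    unfolding s2ser_def cser_def[symmetric] cser_eq[symmetric] by (simp add: mult.left_commute)
qed

text \<open>Multiplying \<open>x = y (1 + x^2)\<close> by \<open>s^2\<close> gives
  \<open>x s^2 = y (1 + p q)\<close>, which is half of \<open>p + q\<close>.\<close>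

lemma xser_s2ser: "2 * xser * s2ser = var_p + var_q"
proof -
  have "xser = yser * (1 + xser ^ 2)"
    unfolding cser_eq[symmetric] by (simp add: xser_def cser_def)
  then show ?thesis
    using s2ser_eq yser_eq by algebra
qed

text \<open>The sum of the two preceding identities; \<open>1 + p q + p + q\<close> factors. These
  two relations are all that the comparison with Eulerian polynomials needs to know of
  \<open>x\<close> and \<open>s^2\<close>.\<close>

lemma one_plus_xser_s2ser: "(1 + xser) ^ 2 * s2ser = (1 + var_p) * (1 + var_q)"
  using s2ser_eq xser_s2ser by algebra

section \<open>Alternating convolutions of Eulerian polynomials\<close>

definition egf :: "(nat \<Rightarrow> fps2) \<Rightarrow> fps2 fps" where
  "egf f = Abs_fps (\<lambda>n. f n * sc (1 / fact n))"

lemma sc_1 [simp]: "sc 1 = 1"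
  by (simp add: sc_def)

lemma sc_of_nat: "sc (of_nat n) = of_nat n"
  by (simp add: sc_def fps_of_nat)

lemma egf_nth_0 [simp]: "egf f $ 0 = f 0"
  by (simp add: egf_def)

lemma egf_eq_iff: "egf f = egf g \<longleftrightarrow> f = g"
proof
  assume *: "egf f = egf g"
  show "f = g"
  proof
    fix n
    have "egf f $ n * sc (fact n) = egf g $ n * sc (fact n)"
      using * by simp
    then show "f n = g n"
      by (simp add: egf_def mult.assoc sc_mult)
  qed
qed simp

lemma egf_add: "egf f + egf g = egf (\<lambda>n. f n + g n)"
  by (simp add: egf_def fps_eq_iff algebra_simps)

lemma egf_diff: "egf f - egf g = egf (\<lambda>n. f n - g n)"
  by (simp add: egf_def fps_eq_iff algebra_simps)

lemma egf_uminus: "- egf f = egf (\<lambda>n. - f n)"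
  by (simp add: egf_def fps_eq_iff)

lemma egf_const_mult: "fps_const c * egf f = egf (\<lambda>n. c * f n)"
  by (simp add: egf_def fps_eq_iff mult.assoc)

lemma egf_deriv: "fps_deriv (egf f) = egf (\<lambda>n. f (Suc n))"
proof (rule fps_ext)
  fix n
  have "of_nat (Suc n) * sc (1 / fact (Suc n)) = sc (1 / fact n)"
    unfolding sc_of_nat[symmetric] sc_mult
    by (rule arg_cong[where f = sc]) (simp add: fact_Suc del: of_nat_Suc)
  then show "fps_deriv (egf f) $ n = egf (\<lambda>n. f (Suc n)) $ n"
    by (simp add: egf_def mult.left_commute del: fact_Suc of_nat_Suc)
qed

lemma egf_mult:
  "egf f * egf g = egf (\<lambda>n. \<Sum>k\<le>n. of_nat (n choose k) * (f k * g (n - k)))"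
proof (rule fps_ext)
  fix n
  have "f k * sc (1 / fact k) * (g (n - k) * sc (1 / fact (n - k))) =
      of_nat (n choose k) * (f k * g (n - k)) * sc (1 / fact n)" if "k \<le> n" for k
  proof -
    have "sc (1 / fact k) * sc (1 / fact (n - k)) = of_nat (n choose k) * sc (1 / fact n)"
      unfolding sc_of_nat[symmetric] sc_mult using that by (simp add: binomial_fact)
    then have "f k * g (n - k) * (sc (1 / fact k) * sc (1 / fact (n - k))) =
        f k * g (n - k) * (of_nat (n choose k) * sc (1 / fact n))"
      by simp
    then show ?thesis by (simp only: mult_ac)
  qed
  then show "(egf f * egf g) $ n =
      egf (\<lambda>n. \<Sum>k\<le>n. of_nat (n choose k) * (f k * g (n - k))) $ n"
    by (simp only: egf_def fps_mult_nth fps_nth_Abs_fps atLeast0AtMost sum_distrib_right)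
       (rule sum.cong; simp only: atMost_iff)
qed

text \<open>The equation expresses each coefficient of \<open>h\<close> through earlier ones, so all
  vanish with the first.\<close>

lemma fps_linear_ode_zero:
  fixes g h :: "'a::{idom,semiring_char_0} fps"
  assumes "fps_deriv h = g * h" "h $ 0 = 0"
  shows "h = 0"
proof (rule fps_ext)
  fix n show "h $ n = 0 $ n"
  proof (induction n rule: less_induct)
    case (less n)
    show ?case
    proof (cases n)
      case (Suc m)
      have "of_nat (Suc m) * h $ Suc m = (g * h) $ m"
        using arg_cong[OF assms(1), of "\<lambda>u. u $ m"] by simp
      also have "\<dots> = 0"
        using less Suc by (simp add: fps_mult_nth)
      finally show ?thesis
        using Suc of_nat_neq_0[of m, where 'a = 'a] by simp
    qed (simp add: assms)
  qed
qed

text \<open>This is the coefficient of \<open>t^n\<close> in the functional equation for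
  \<open>E(t) E(-t)\<close>, with the two end terms of the convolution removed. It will control the
  difference between even and odd \<open>k\<close>.\<close>

lemma eulerian_alternating:
  fixes x :: fps2
  assumes "even n" "0 < n"
  shows "(1 + x) * (\<Sum>k=1..<n. of_nat (n choose k) * ((-1) ^ k * eulerian k x * eulerian (n - k) x))
    = - 2 * eulerian n x"
proof -
  define e where "e k = eulerian k x" for k
  define E where "E = egf e"
  \<comment> \<open>\<open>F\<close> is \<open>E(-t)\<close>.\<close>
  define F where "F = egf (\<lambda>k. (-1) ^ k * e k)"
  define X where "X = fps_const x"
  \<comment> \<open>Extending the sum to \<open>k = n\<close> makes it a full binomial convolution;
    the extra term is compensated by \<open>- x * e n\<close>.\<close>
  have e_Suc: "e (Suc n) = e n - x * e n + x * (\<Sum>k\<le>n. of_nat (n choose k) * (e k * e (n - k)))" for n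
    by (simp add: e_def eulerian_Suc lessThan_Suc_atMost[symmetric] algebra_simps)
  have E': "fps_deriv E = E - X * E + X * (E * E)"
    by (simp add: E_def X_def egf_deriv egf_mult egf_const_mult egf_add egf_diff egf_eq_iff
        fun_eq_iff e_Suc)
  have pow: "(-1) ^ k * e k * ((-1) ^ (n - k) * e (n - k)) = (-1) ^ n * (e k * e (n - k))"
    if "k \<le> n" for k n
  proof -
    have "(-1::fps2) ^ n = (-1) ^ k * (-1) ^ (n - k)"
      using that by (simp flip: power_add)
    then show ?thesis by (simp only: mult_ac)
  qed
  have F': "fps_deriv F = - (F - X * F + X * (F * F))"
  proof -
    have "(-1) ^ Suc n * e (Suc n) = - ((-1) ^ n * e n - x * ((-1) ^ n * e n) +
        x * (\<Sum>k\<le>n. of_nat (n choose k) * ((-1) ^ k * e k * ((-1) ^ (n - k) * e (n - k)))))" for n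
    proof -
      have "(\<Sum>k\<le>n. of_nat (n choose k) * ((-1) ^ k * e k * ((-1) ^ (n - k) * e (n - k)))) =
          (-1) ^ n * (\<Sum>k\<le>n. of_nat (n choose k) * (e k * e (n - k)))"
        unfolding sum_distrib_left
        by (intro sum.cong refl) (simp only: atMost_iff pow, simp only: mult_ac)
      then show ?thesis
        by (simp add: e_Suc algebra_simps)
    qed
    then show ?thesis
      by (simp only: F_def X_def egf_deriv egf_mult egf_const_mult egf_add egf_diff egf_uminus)
  qed
  define H where "H = (1 + X) * (E * F) - X * (E + F) + X - 1"
  \<comment> \<open>Both \<open>E'F + EF'\<close> and \<open>E' + F'\<close> are divisible by
    \<open>E - F\<close>: the cofactors are \<open>X E F\<close> and
    \<open>1 - X + X (E + F)\<close>, and they combine to \<open>X H\<close>.\<close>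
  have "fps_deriv H = (1 + X) * (fps_deriv E * F + E * fps_deriv F) - X * (fps_deriv E + fps_deriv F)"
    by (simp add: H_def X_def algebra_simps)
  also have "\<dots> = X * (E - F) * H"
    unfolding E' F' H_def by algebra
  finally have "H = 0"
    by (rule fps_linear_ode_zero) (simp add: H_def E_def F_def X_def e_def)
  define p where "p n = (\<Sum>k\<le>n. of_nat (n choose k) * ((-1) ^ k * e k * e (n - k)))" for n
  have FE: "F * E = egf p"
    by (simp add: F_def E_def egf_mult p_def[abs_def])
  have "fps_const (1 + x) * (F * E) - fps_const x * (E + F) = H + 1 - X"
    unfolding H_def X_def fps_const_add[symmetric] by (simp add: algebra_simps)
  also have "\<dots> = fps_const (1 - x)"
    unfolding \<open>H = 0\<close> X_def by (simp flip: fps_const_sub)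
  finally have "egf (\<lambda>n. (1 + x) * p n - x * (e n + (-1) ^ n * e n)) = fps_const (1 - x)"
    by (simp only: FE, simp only: E_def F_def egf_add egf_const_mult egf_diff)
  then have "egf (\<lambda>n. (1 + x) * p n - x * (e n + (-1) ^ n * e n)) $ n * sc (fact n) = 0"
    using assms(2) by simp
  then have "(1 + x) * p n = 2 * x * e n"
    using assms(1) by (simp add: egf_def mult.assoc sc_mult algebra_simps)
  \<comment> \<open>The terms \<open>k = 0\<close> and \<open>k = n\<close> both equal
    \<open>e n\<close>, as \<open>n\<close> is even and \<open>e 0 = 1\<close>. Removing them turns
    \<open>2 x e n\<close> into \<open>-2 e n\<close>.\<close>
  moreover have "p n = (\<Sum>k=1..<n. of_nat (n choose k) * ((-1) ^ k * e k * e (n - k))) + 2 * e n"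
  proof -
    have "{..n} = insert 0 (insert n {1..<n})"
      using assms(2) by auto
    then show ?thesis
      using assms by (simp add: p_def) (simp add: e_def)
  qed
  ultimately show ?thesis
    unfolding e_def[symmetric] by algebra
qed

section \<open>Comparison of the two families\<close>

text \<open>For odd \<open>n\<close> the reflection of \<open>k\<close> to \<open>n - k\<close>
  exchanges the parities, so the weights \<open>a\<close> and \<open>b\<close> may be
  averaged.\<close>

lemma sum_binomial_parity_sym:
  fixes a b :: "'a::comm_ring_1"
  assumes "odd n"
  shows "2 * (\<Sum>k=1..<n. of_nat (n choose k) * ((if even k then a else b) * (f k * f (n - k)))) =
    (a + b) * (\<Sum>k=1..<n. of_nat (n choose k) * (f k * f (n - k)))"
proof -
  let ?T = "\<lambda>a b. \<Sum>k=1..<n. of_nat (n choose k) * ((if even k then a else b) * (f k * f (n - k)))"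
  have "?T a b = ?T b a"
  proof (rule sum.reindex_bij_witness[of _ "\<lambda>k. n - k" "\<lambda>k. n - k"])
    fix k assume k: "k \<in> {1..<n}"
    then have "even (n - k) \<longleftrightarrow> odd k" "n choose (n - k) = n choose k"
      using assms by (auto simp: binomial_symmetric[symmetric])
    then show "of_nat (n choose (n - k)) * ((if even (n - k) then b else a) * (f (n - k) * f (n - (n - k))))
      = of_nat (n choose k) * ((if even k then a else b) * (f k * f (n - k)))"
      using k by (auto simp: mult_ac)
  qed auto
  then have "2 * ?T a b = ?T a b + ?T b a"
    by simp
  also have "\<dots> = (a + b) * (\<Sum>k=1..<n. of_nat (n choose k) * (f k * f (n - k)))"
    by (auto simp: sum_distrib_left algebra_simps simp flip: sum.distrib intro!: sum.cong)
  finally show ?thesis .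
qed

text \<open>The term \<open>k = 0\<close> is split off because the even-index comparison below is
  stated for positive indices only.\<close>

lemma descent_poly_Suc':
  assumes "0 < n"
  shows "descent_poly (Suc n) a b = descent_poly n a b + a * descent_poly n b a +
    (\<Sum>k=1..<n. of_nat (n choose k) * (descent_poly k a b *
      (if even k then a * descent_poly (n - k) b a else b * descent_poly (n - k) a b)))"
proof -
  have "{..<n} = insert 0 {1..<n}" using assms by auto
  then show ?thesis by (simp add: descent_poly_Suc descent_step_def)
qed

lemma eulerian_Suc':
  assumes "0 < n"
  shows "eulerian (Suc n) z = (1 + z) * eulerian n z +
    z * (\<Sum>k=1..<n. of_nat (n choose k) * (eulerian k z * eulerian (n - k) z))"
proof -
  have "{..<n} = insert 0 {1..<n}" using assms by auto
  then show ?thesis by (simp add: eulerian_Suc algebra_simps)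
qed

text \<open>The parameters are arbitrary because the induction also needs the claim for
  \<open>(b, a)\<close>; the relations are symmetric in them. Denominators are cleared, and nonzero
  factors are cancelled in the integral domain \<open>fps2\<close>.\<close>

lemma descent_poly_eulerian:
  fixes a b x s :: fps2
  assumes xs: "2 * x * s = a + b" and sx: "(1 + x) ^ 2 * s = (1 + a) * (1 + b)"
    and nz: "1 + a \<noteq> 0" "1 + b \<noteq> 0" "0 < n"
  shows "if even n then (1 + b) * descent_poly n a b = (1 + x) * (eulerian n x * s ^ (n div 2))
    else descent_poly n a b = eulerian n x * s ^ (n div 2)"
  using assms
proof (induction n arbitrary: a b rule: less_induct)
  case (less N a b)
  let ?P = "\<lambda>k. descent_poly k a b" and ?Q = "\<lambda>k. descent_poly k b a" and ?e = "\<lambda>k. eulerian k x"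
  note P = less.IH[OF _ less.prems(1-4)]
  have "2 * x * s = b + a" "(1 + x) ^ 2 * s = (1 + b) * (1 + a)"
    using less.prems by (simp_all add: add.commute mult.commute)
  note Q = less.IH[OF _ this less.prems(4,3)]
  have Po: "?P k = ?e k * s ^ (k div 2)" and Qo: "?Q k = ?e k * s ^ (k div 2)"
    if "k < N" "odd k" for k
    using P[of k] Q[of k] that by (auto elim: oddE)
  have Pe: "(1 + b) * ?P k = (1 + x) * (?e k * s ^ (k div 2))"
    and Qe: "(1 + a) * ?Q k = (1 + x) * (?e k * s ^ (k div 2))"
    if "k < N" "even k" "0 < k" for k
    using P[of k] Q[of k] that by auto
  obtain n where N: "N = Suc n"
    using less.prems(5) by (cases N) auto
  let ?m = "n div 2"
  let ?T = "\<Sum>k=1..<n. of_nat (n choose k) * ((if even k then a else b) * (?e k * ?e (n - k)))"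
  let ?S = "\<Sum>k=1..<n. of_nat (n choose k) * (?e k * ?e (n - k))"
  let ?R = "\<lambda>k. ?P k * (if even k then a * ?Q (n - k) else b * ?P (n - k))"
  consider "n = 0" | "odd n" | "even n" "0 < n" by blast
  then show ?case
  proof cases
    case 1
    then show ?thesis
      by (simp add: N descent_poly_Suc descent_step_def eulerian_Suc)
  next
    case 2
    then have "0 < n" by (auto elim: oddE)
    \<comment> \<open>Exactly one of \<open>k\<close> and \<open>n - k\<close> is even. The
      polynomial of that index has second parameter \<open>b\<close> or is \<open>?P k\<close>, so
      it absorbs \<open>1 + b\<close> and yields \<open>1 + x\<close>.\<close>
    have R: "(1 + b) * ?R k = (1 + x) * s ^ ?m * ((if even k then a else b) * (?e k * ?e (n - k)))"
      if k: "k \<in> {1..<n}" for k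
    proof (cases "even k")
      case True
      then have "?m = k div 2 + (n - k) div 2" "odd (n - k)"
        using 2 k by (auto elim!: evenE oddE)
      moreover from True have "(1 + b) * ?R k = a * ((1 + b) * ?P k * ?Q (n - k))"
        by (simp add: mult_ac)
      ultimately show ?thesis
        using k True Pe[of k] Qo[of "n - k"] N by (simp add: power_add mult_ac)
    next
      case False
      then have "?m = k div 2 + (n - k) div 2" "even (n - k)"
        using 2 k by (auto elim!: oddE)
      moreover from False have "(1 + b) * ?R k = b * (?P k * ((1 + b) * ?P (n - k)))"
        by (simp add: mult_ac)
      ultimately show ?thesis
        using k False Po[of k] Pe[of "n - k"] N by (simp add: power_add mult_ac)
    qed
    have "(1 + b) * (\<Sum>k=1..<n. of_nat (n choose k) * ?R k) = (1 + x) * s ^ ?m * ?T"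
      unfolding sum_distrib_left
      by (intro sum.cong refl) (simp only: mult.left_commute[of _ "of_nat _"] R)
    then have "(1 + b) * ?P N = (1 + b) * (?P n + a * ?Q n) + (1 + x) * s ^ ?m * ?T"
      unfolding N descent_poly_Suc'[OF \<open>0 < n\<close>] by (simp only: distrib_left)
    moreover have "?P n = ?e n * s ^ ?m" "?Q n = ?e n * s ^ ?m"
      using 2 N Po Qo by auto
    ultimately have "2 * ((1 + b) * ?P N) =
        2 * ((1 + a) * (1 + b) * (?e n * s ^ ?m)) + (1 + x) * s ^ ?m * (2 * ?T)"
      by (simp only: distrib_left distrib_right mult_1_left mult_1_right add_ac mult_ac)
    also have "2 * ?T = (a + b) * ?S"
      by (rule sum_binomial_parity_sym[OF 2])
    \<comment> \<open>Both relations supply a factor \<open>s\<close>, which raises the exponent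
      from \<open>n div 2\<close> to \<open>N div 2\<close>.\<close>
    also have "2 * ((1 + a) * (1 + b) * (?e n * s ^ ?m)) + (1 + x) * s ^ ?m * ((a + b) * ?S) =
        2 * ((1 + x) * (((1 + x) * ?e n + x * ?S) * (s * s ^ ?m)))"
      unfolding less.prems(1,2)[symmetric]
      by (simp only: power2_eq_square distrib_left distrib_right mult_1_left mult_1_right
          add_ac mult_ac)
    also have "(1 + x) * ?e n + x * ?S = ?e N"
      unfolding N by (rule eulerian_Suc'[OF \<open>0 < n\<close>, symmetric])
    finally have "2 * ((1 + b) * ?P N) = 2 * ((1 + x) * (?e N * (s * s ^ ?m)))" .
    then show ?thesis
      using 2 N by (simp add: mult_ac)
  next
    case 3
    \<comment> \<open>For even \<open>k\<close> each factor of \<open>?R k\<close> yields one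
      \<open>1 + x\<close>. For odd \<open>k\<close> the exponents of \<open>s\<close> add up to
      only \<open>n div 2 - 1\<close>, and \<open>(1 + a) * (1 + b)\<close> provides the missing
      \<open>s\<close> together with \<open>(1 + x)^2\<close>.\<close>
    have R: "(1 + a) * (1 + b) * ?R k =
        (1 + x) ^ 2 * s ^ ?m * ((if even k then a else b) * (?e k * ?e (n - k)))"
      if k: "k \<in> {1..<n}" for k
    proof (cases "even k")
      case True
      then have m: "?m = k div 2 + (n - k) div 2" "even (n - k)"
        using 3 k by (auto elim!: evenE)
      moreover from True have
        "(1 + a) * (1 + b) * ?R k = a * (((1 + b) * ?P k) * ((1 + a) * ?Q (n - k)))"
        by (simp add: mult_ac)
      moreover have "(1 + b) * ?P k = (1 + x) * (?e k * s ^ (k div 2))"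
        "(1 + a) * ?Q (n - k) = (1 + x) * (?e (n - k) * s ^ ((n - k) div 2))"
        using k True m N by (intro Pe Qe; simp)+
      ultimately show ?thesis
        using True m by (simp only: power_add power2_eq_square if_True mult_ac)
    next
      case False
      then have m: "?m = Suc (k div 2 + (n - k) div 2)" "odd (n - k)"
        using 3 k by (auto elim!: evenE oddE)
      have "(1 + a) * (1 + b) * ?R k = b * ((1 + a) * (1 + b) * (?P k * ?P (n - k)))"
        using False by (simp add: mult_ac)
      then show ?thesis
        using k False Po[of k] Po[of "n - k"] N m
        by (simp add: less.prems(2)[symmetric] power_add mult_ac)
    qed
    have "(1 + a) * (1 + b) * (\<Sum>k=1..<n. of_nat (n choose k) * ?R k) = (1 + x) ^ 2 * s ^ ?m * ?T"
      unfolding sum_distrib_left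
      by (intro sum.cong refl) (simp only: mult.left_commute[of _ "of_nat _"] R)
    then have *: "(1 + a) * (1 + b) * ?P N =
        (1 + a) * (1 + b) * (?P n + a * ?Q n) + (1 + x) ^ 2 * s ^ ?m * ?T"
      unfolding N descent_poly_Suc'[OF 3(2)] by (simp only: distrib_left)
    define D where
      "D = (\<Sum>k=1..<n. of_nat (n choose k) * ((-1) ^ k * ?e k * ?e (n - k)))"
    have D: "(1 + x) * D = - 2 * ?e n"
      unfolding D_def by (rule eulerian_alternating[OF 3])
    \<comment> \<open>Twice the weight of \<open>k\<close> is
      \<open>(a + b) + (-1)^k (a - b)\<close>.\<close>
    have T: "2 * ?T = (a + b) * ?S + (a - b) * D"
      unfolding D_def sum_distrib_left sum.distrib[symmetric]
      by (intro sum.cong refl) (auto simp: algebra_simps)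
    have Pn: "(1 + b) * ?P n = (1 + x) * (?e n * s ^ ?m)"
      and Qn: "(1 + a) * ?Q n = (1 + x) * (?e n * s ^ ?m)"
      using 3 N Pe Qe by auto
    define S T M where "S = ?S" and "T = ?T" and "M = s ^ ?m"
    have "2 * ((1 + a) * (1 + b) * ?P N) =
        2 * ((1 + a) * ((1 + b) * ?P n) + a * (1 + b) * ((1 + a) * ?Q n)) +
        (1 + x) ^ 2 * M * (2 * T)"
      unfolding * T_def[symmetric] M_def[symmetric] by algebra
    also have "\<dots> = 2 * (((1 + a) + a * (1 + b)) * ((1 + x) * (?e n * M))) +
        (1 + x) ^ 2 * M * (a + b) * S + (1 + x) * M * (a - b) * ((1 + x) * D)"
      unfolding Pn[folded M_def] Qn[folded M_def] T[folded S_def T_def] by algebra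
    \<comment> \<open>The value of \<open>D\<close> contributes \<open>-(a - b)\<close>, and
      \<open>(1 + a) + a (1 + b) - (a - b)\<close> equals \<open>(1 + a) (1 + b)\<close>.\<close>
    also have "\<dots> = 2 * ((1 + a) * (1 + b) * ((1 + x) * ?e n * M)) +
        (1 + x) ^ 2 * s * (2 * x * M * S)"
      unfolding D less.prems(1)[symmetric] by algebra
    also have "\<dots> = 2 * ((1 + a) * (1 + b) * (((1 + x) * ?e n + x * S) * M))"
      unfolding less.prems(2) by algebra
    also have "(1 + x) * ?e n + x * S = ?e N"
      unfolding N S_def by (rule eulerian_Suc'[OF 3(2), symmetric])
    finally have "2 * ((1 + a) * (1 + b) * ?P N) = 2 * ((1 + a) * (1 + b) * (?e N * s ^ ?m))"
      unfolding M_def .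
    then have "?P N = ?e N * s ^ ?m"
      using less.prems(3,4) by simp
    then show ?thesis
      using 3 N by simp
  qed
qed

theorem theorem2p2:
  shows "(Abs_fps (\<lambda>m. if even m \<and> m \<ge> 1 then Apq m * sc (1 / fact m) else 0)
           = fps_const ((1 + xser) * inverse (1 + var_q)) * (E_even xser s2ser - 1)
       \<and> Abs_fps (\<lambda>m. if odd m then Apq m * sc (1 / fact m) else 0)
           = E_odd_div_s xser s2ser)"
proof -
  have unit: "coeff2 (1 + var_p) 0 0 \<noteq> 0" "coeff2 (1 + var_q) 0 0 \<noteq> 0"
    by (simp_all add: coeff2_def var_p_def var_q_def)
  then have nz: "1 + var_p \<noteq> 0" "1 + var_q \<noteq> 0"
    by auto
  note main = descent_poly_eulerian[OF xser_s2ser one_plus_xser_s2ser nz, folded Apq_eq_descent_poly]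
  have odd: "Apq m = eulerian m xser * s2ser ^ (m div 2)" if "odd m" for m
    using main[of m] that by (auto elim: oddE)
  \<comment> \<open>The constant term of \<open>1 + q\<close> is 1, so the even relation can be
    divided by it.\<close>
  have even: "Apq m = (1 + xser) * inverse (1 + var_q) * (eulerian m xser * s2ser ^ (m div 2))"
    if "even m" "1 \<le> m" for m
  proof -
    have "(1 + var_q) * Apq m = (1 + xser) * (eulerian m xser * s2ser ^ (m div 2))"
      using main[of m] that by simp
    then have "inverse (1 + var_q) * ((1 + var_q) * Apq m) =
        inverse (1 + var_q) * ((1 + xser) * (eulerian m xser * s2ser ^ (m div 2)))"
      by simp
    also have "inverse (1 + var_q) * ((1 + var_q) * Apq m) = Apq m"
      using inverse_fps2[OF unit(2)] by (metis mult.assoc mult.commute mult_1_right)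
    finally show ?thesis by (simp only: mult_ac)
  qed
  show ?thesis
  proof (rule conjI; rule fps_ext)
    fix m
    \<comment> \<open>At \<open>m = 0\<close> both sides vanish, since subtracting 1 removes the
      constant term of \<open>E_even\<close>.\<close>
    show "Abs_fps (\<lambda>m. if even m \<and> m \<ge> 1 then Apq m * sc (1 / fact m) else 0) $ m =
        (fps_const ((1 + xser) * inverse (1 + var_q)) * (E_even xser s2ser - 1)) $ m"
      by (auto simp: E_even_def even mult.assoc)
    show "Abs_fps (\<lambda>m. if odd m then Apq m * sc (1 / fact m) else 0) $ m =
        E_odd_div_s xser s2ser $ m"
      by (simp add: E_odd_div_s_def odd)
  qed
qed

end
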